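(* Let $X$ be a compact metrizable space and $d$ a metric on $X$ compatible with its topology. For a nonempty closed subset $K\subseteq X$ let $\mathcal{F}_K:=\{\mu\in\mathcal{S}C(X):\operatorname{supp}(\mu)\subseteq K\}$. Then for all nonempty closed subsets $K,K'$ of $X$, $$\mathcal{I}_d(K,K')=\mathcal{I}_{\rho_d}(\mathcal{F}_K,\mathcal{F}_{K'}).$$
   Context: $C(X)$ is the C*-algebra of complex-valued continuous functions on $X$, and $C(X)_{\mathrm{sa}}$ its self-adjoint part (the real-valued continuous functions). $\mathcal{S}C(X)$ is the state space of $C(X)$ with the weak* topology, identified with the space of regular Borel probability measures on $X$; $\mu(f)=\int f\,d\mu$. The Lipschitz seminorm is $\mathcal{L}_d(f):=\sup\{|f(x)-f(y)|/d(x,y):x,y\in X,\ x\neq y\}\in[0,\infty]$ for $f\in C(X)_{\mathrm{sa}}$, and the Monge–Kantorovich distance on $\mathcal{S}C(X)$ is $$\rho_d(\mu,\nu):=\sup\{|\mu(f)-\nu(f)|:f\in C(X)_{\mathrm{sa}},\ \mathcal{L}_d(f)\leq1\}.$$ For a metric $\rho$ on a set $Y$ and nonempty subsets $S,S'\subseteq Y$, the infimum distance is $\mathcal{I}_\rho(S,S'):=\inf\{\rho(x,y):x\in S,\ y\in S'\}$. *)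

theory Defs
  imports "HOL-Probability.Probability"
begin

text \<open>
  The compact space \<open>X\<close> is the universe of a type of class \<open>topological_space\<close>; the metric \<open>d\<close> is an
  explicit function, so that the same distance between sets applies to \<open>d\<close> and to the induced
  distance on states.  States of \<open>C(X)\<close> are represented by regular Borel probability measures.
\<close>

definition regular_borel :: "'a::topological_space measure \<Rightarrow> bool" where
  "regular_borel M \<longleftrightarrow> sets M = sets borel \<and>
     (\<forall>A\<in>sets borel.
        emeasure M A = (SUP C\<in>{C. C \<subseteq> A \<and> compact C}. emeasure M C) \<and>
        emeasure M A = (INF U\<in>{U. A \<subseteq> U \<and> open U}. emeasure M U))"

definition state_space :: "'a::topological_space measure set" where
  "state_space = {\<mu>. prob_space \<mu> \<and> regular_borel \<mu>}"

definition measure_support :: "'a::topological_space measure \<Rightarrow> 'a set" where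
  "measure_support \<mu> = - \<Union>{U. open U \<and> emeasure \<mu> U = 0}"

definition states_on :: "'a::topological_space set \<Rightarrow> 'a measure set" where
  "states_on K = {\<mu> \<in> state_space. measure_support \<mu> \<subseteq> K}"

text \<open>Valued in \<open>[0,\<infinity>]\<close>; on a one-point space the supremum over no pairs is \<open>0\<close>.\<close>

definition lip_seminorm :: "('a \<Rightarrow> 'a \<Rightarrow> real) \<Rightarrow> ('a \<Rightarrow> real) \<Rightarrow> ennreal" where
  "lip_seminorm d f = (SUP (x, y)\<in>{(x, y). x \<noteq> y}. ennreal (\<bar>f x - f y\<bar> / d x y))"

text \<open>
  A real supremum; \<open>mk_dist_bdd_above\<close> below shows that it is over a bounded set for states on a
  compact space.
\<close>

definition mk_dist :: "('a::topological_space \<Rightarrow> 'a \<Rightarrow> real) \<Rightarrow> 'a measure \<Rightarrow> 'a measure \<Rightarrow> real" where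
  "mk_dist d \<mu> \<nu> = Sup {\<bar>(\<integral>x. f x \<partial>\<mu>) - (\<integral>x. f x \<partial>\<nu>)\<bar> | f.
     continuous_on UNIV f \<and> lip_seminorm d f \<le> 1}"

definition inf_dist :: "('b \<Rightarrow> 'b \<Rightarrow> real) \<Rightarrow> 'b set \<Rightarrow> 'b set \<Rightarrow> real" where
  "inf_dist \<rho> S S' = Inf {\<rho> x y | x y. x \<in> S \<and> y \<in> S'}"

lemma lip_seminorm_le_1D:
  assumes "Metric_space UNIV d" "lip_seminorm d f \<le> 1"
  shows "\<bar>f x - f y\<bar> \<le> d x y"
proof (cases "x = y")
  case True
  then show ?thesis
    using Metric_space.nonneg[OF assms(1), of x y] by simp
next
  case False
  have "ennreal (\<bar>f x - f y\<bar> / d x y) \<le> lip_seminorm d f"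
    unfolding lip_seminorm_def using False by (intro SUP_upper2[of "(x, y)"]) auto
  also note assms(2)
  finally have "\<bar>f x - f y\<bar> / d x y \<le> 1"
    by (simp only: ennreal_le_1)
  moreover have "d x y > 0"
    using False Metric_space.mdist_pos_eq[OF assms(1), of x y] by simp
  ultimately show ?thesis
    by (simp add: field_simps)
qed

lemma mk_dist_bdd_above:
  fixes d :: "'a::topological_space \<Rightarrow> 'a \<Rightarrow> real"
  assumes "compact (UNIV :: 'a set)"
    and d: "Metric_space UNIV d" "Metric_space.mtopology UNIV d = euclidean"
    and "\<mu> \<in> state_space" "\<nu> \<in> state_space"
  shows "bdd_above {\<bar>(\<integral>x. f x \<partial>\<mu>) - (\<integral>x. f x \<partial>\<nu>)\<bar> | f.
     continuous_on UNIV f \<and> lip_seminorm d f \<le> 1}"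
proof -
  interpret Metric_space UNIV d by (rule d)
  have "compactin mtopology UNIV"
    using assms(1) by (simp add: d(2))
  then have "mbounded UNIV"
    by (rule compactin_imp_mbounded)
  then obtain B where B: "\<And>x y. d x y \<le> B"
    unfolding mbounded_alt by auto
  fix a :: 'a
  have close: "\<bar>(\<integral>x. f x \<partial>M) - f a\<bar> \<le> B"
    if M: "M \<in> state_space" and f: "continuous_on UNIV f" "lip_seminorm d f \<le> 1"
    for M :: "'a measure" and f :: "'a \<Rightarrow> real"
  proof -
    interpret prob_space M using M by (simp add: state_space_def)
    have sets: "sets M = sets borel"
      using M by (simp add: state_space_def regular_borel_def)
    have meas: "f \<in> borel_measurable M"
      using borel_measurable_continuous_onI[OF f(1)] measurable_cong_sets[OF sets refl] by blast
    have fB: "\<bar>f x - f a\<bar> \<le> B" for x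
      using lip_seminorm_le_1D[OF d(1) f(2)] B order_trans by blast
    have "\<bar>f x\<bar> \<le> \<bar>f a\<bar> + B" for x
      using fB[of x] by linarith
    then have int: "integrable M f"
      by (intro integrable_const_bound[of _ "\<bar>f a\<bar> + B"] meas) auto
    have "(\<integral>x. f x \<partial>M) - f a = (\<integral>x. f x - f a \<partial>M)"
      using int by (simp add: prob_space)
    also have "\<bar>\<dots>\<bar> \<le> (\<integral>x. \<bar>f x - f a\<bar> \<partial>M)"
      by (rule integral_abs_bound)
    also have "\<dots> \<le> (\<integral>x. B \<partial>M)"
      using int by (intro integral_mono) (auto simp: fB)
    finally show ?thesis
      by (simp add: prob_space)
  qed
  show ?thesis
  proof (rule bdd_aboveI[of _ "2 * B"])
    fix r
    assume "r \<in> {\<bar>(\<integral>x. f x \<partial>\<mu>) - (\<integral>x. f x \<partial>\<nu>)\<bar> | f. continuous_on UNIV f \<and> lip_seminorm d f \<le> 1}"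
    then obtain f where f: "continuous_on UNIV f" "lip_seminorm d f \<le> 1"
      and r: "r = \<bar>(\<integral>x. f x \<partial>\<mu>) - (\<integral>x. f x \<partial>\<nu>)\<bar>" by blast
    show "r \<le> 2 * B"
      using close[OF assms(4) f] close[OF assms(5) f] r by linarith
  qed
qed

end

theory Submission
  imports Defs
begin

text \<open>
  Write \<open>c\<close> for the distance between \<open>K\<close> and \<open>K'\<close>.  Point masses embed \<open>X\<close> into the state space
  without increasing distances (\<open>mk_dist_return_le\<close>) and send the points of \<open>K\<close> to states supported
  on \<open>K\<close> (\<open>return_in_states_on\<close>), so the distance between the two sets of states is at most \<open>c\<close>.

  For the converse a single test function serves all pairs of states.  The function \<open>f\<close> that measures
  the distance to \<open>K\<close> has Lipschitz constant at most \<open>1\<close>, vanishes on \<open>K\<close> and is at least \<open>c\<close> on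
  \<open>K'\<close>.  A state supported on \<open>K\<close> is concentrated on \<open>K\<close> (\<open>AE_in_support_set\<close>, where regularity
  enters), so \<open>f\<close> has mean at most \<open>0\<close> under such a state and mean at least \<open>c\<close> under a state
  supported on \<open>K'\<close> (\<open>mk_dist_ge_separation\<close>).
\<close>

section \<open>Infimum distance\<close>

lemma inf_dist_lower:
  assumes "x \<in> S" "y \<in> S'" "\<And>x y. x \<in> S \<Longrightarrow> y \<in> S' \<Longrightarrow> c \<le> \<rho> x y"
  shows "inf_dist \<rho> S S' \<le> \<rho> x y"
  unfolding inf_dist_def using assms by (intro cInf_lower bdd_belowI[of _ c]) auto

lemma inf_dist_greatest:
  assumes "S \<noteq> {}" "S' \<noteq> {}" "\<And>x y. x \<in> S \<Longrightarrow> y \<in> S' \<Longrightarrow> c \<le> \<rho> x y"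
  shows "c \<le> inf_dist \<rho> S S'"
  unfolding inf_dist_def using assms by (intro cInf_greatest) auto

section \<open>Lipschitz functions and the metric topology\<close>

lemma lip_seminorm_le_1I:
  assumes "Metric_space UNIV d" "\<And>x y. \<bar>f x - f y\<bar> \<le> d x y"
  shows "lip_seminorm d f \<le> 1"
  unfolding lip_seminorm_def
proof (rule SUP_least, clarify)
  fix x y :: 'a assume "x \<noteq> y"
  then have "d x y > 0"
    using Metric_space.mdist_pos_eq[OF assms(1), of x y] by simp
  then show "ennreal (\<bar>f x - f y\<bar> / d x y) \<le> 1"
    using assms(2)[of x y] by (simp add: ennreal_le_1)
qed

lemma continuous_on_if_Lipschitz:
  fixes f :: "'a::topological_space \<Rightarrow> real"
  assumes "Metric_space UNIV d" "Metric_space.mtopology UNIV d = euclidean"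
    and lip: "\<And>x y. \<bar>f x - f y\<bar> \<le> d x y"
  shows "continuous_on UNIV f"
  unfolding continuous_on_topological
proof (intro ballI allI impI)
  interpret Metric_space UNIV d by fact
  fix x B assume "open B" "f x \<in> B"
  then obtain e where e: "e > 0" "ball (f x) e \<subseteq> B"
    using open_contains_ball by blast
  have "open (mball x e)"
    using openin_mball[of x e] by (simp add: assms(2))
  moreover have "f y \<in> B" if "y \<in> mball x e" for y
    using that lip[of x y] e(2) by (intro subsetD[OF e(2)]) (auto simp: dist_real_def)
  ultimately show "\<exists>A. open A \<and> x \<in> A \<and> (\<forall>y\<in>UNIV. y \<in> A \<longrightarrow> f y \<in> B)"
    using e(1) by (intro exI[of _ "mball x e"]) auto
qed

lemma closed_singleton_if_metric:
  fixes d :: "'a::topological_space \<Rightarrow> 'a \<Rightarrow> real" and x :: 'a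
  assumes "Metric_space UNIV d" "Metric_space.mtopology UNIV d = euclidean"
  shows "closed {x}"
proof -
  interpret Metric_space UNIV d by fact
  have "closedin mtopology {x}"
    by (intro closedin_Hausdorff_singleton Hausdorff_space_mtopology) simp
  then show ?thesis
    by (simp add: assms(2))
qed

lemma abs_diff_INF_le:
  assumes "Metric_space UNIV d" "K \<noteq> {}"
  shows "\<bar>(INF z\<in>K. d x z) - (INF z\<in>K. d y z)\<bar> \<le> d x y"
proof -
  interpret Metric_space UNIV d by fact
  have le: "(INF z\<in>K. d x z) \<le> (INF z\<in>K. d y z) + d x y" for x y
  proof -
    have "(INF z\<in>K. d x z) - d x y \<le> (INF z\<in>K. d y z)"
    proof (rule cINF_greatest[OF assms(2)])
      fix z assume "z \<in> K"
      then have "(INF z\<in>K. d x z) \<le> d x z"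
        by (intro cINF_lower bdd_belowI[of _ 0]) auto
      also have "\<dots> \<le> d x y + d y z"
        using triangle by simp
      finally show "(INF z\<in>K. d x z) - d x y \<le> d y z" by simp
    qed
    then show ?thesis by simp
  qed
  show ?thesis
    using le[of x y] le[of y x] by (simp add: commute abs_le_iff)
qed

section \<open>Point masses\<close>

text \<open>
  The complement of a closed point is an open null set.  It gives outer regularity for the sets that
  miss the point, and it confines the support to the point; inner regularity is attained at the
  compact set \<open>{x}\<close>.
\<close>

lemma return_in_states_on:
  fixes x :: "'a::topological_space"
  assumes closed: "closed {x}" and "x \<in> K"
  shows "return borel x \<in> states_on K"
proof -
  have reg: "emeasure (return borel x) A = (SUP C\<in>{C. C \<subseteq> A \<and> compact C}. emeasure (return borel x) C)"
      "emeasure (return borel x) A = (INF U\<in>{U. A \<subseteq> U \<and> open U}. emeasure (return borel x) U)"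
    if A: "A \<in> sets borel" for A
  proof -
    have mono: "emeasure (return borel x) B \<le> emeasure (return borel x) A" if "B \<subseteq> A" for B
      using that A by (intro emeasure_mono) auto
    show "emeasure (return borel x) A = (SUP C\<in>{C. C \<subseteq> A \<and> compact C}. emeasure (return borel x) C)"
    proof (rule antisym)
      show "emeasure (return borel x) A \<le> (SUP C\<in>{C. C \<subseteq> A \<and> compact C}. emeasure (return borel x) C)"
        using A closed by (cases "x \<in> A") (auto intro!: SUP_upper2[of "{x}"])
    qed (auto intro!: SUP_least mono)
    show "emeasure (return borel x) A = (INF U\<in>{U. A \<subseteq> U \<and> open U}. emeasure (return borel x) U)"
    proof (rule antisym)
      show "(INF U\<in>{U. A \<subseteq> U \<and> open U}. emeasure (return borel x) U) \<le> emeasure (return borel x) A"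
      proof (cases "x \<in> A")
        case True
        then show ?thesis using A by (intro INF_lower2[of UNIV]) auto
      next
        case False
        then show ?thesis using A closed by (intro INF_lower2[of "- {x}"]) auto
      qed
    qed (rule INF_greatest, rule emeasure_mono, auto)
  qed
  have "return borel x \<in> state_space"
    unfolding state_space_def regular_borel_def
    by (intro CollectI conjI ballI reg prob_space_return) auto
  moreover have "measure_support (return borel x) \<subseteq> {x}"
    using closed unfolding measure_support_def
    by (auto intro!: exI[of _ "- {x}"])
  ultimately show ?thesis
    using assms(2) by (auto simp: states_on_def)
qed

lemma mk_dist_return_le:
  fixes d :: "'a::topological_space \<Rightarrow> 'a \<Rightarrow> real"
  assumes "Metric_space UNIV d"
  shows "mk_dist d (return borel x) (return borel y) \<le> d x y"
  unfolding mk_dist_def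
proof (rule cSup_least)
  have "continuous_on UNIV (\<lambda>_::'a. 0::real) \<and> lip_seminorm d (\<lambda>_. 0) \<le> 1"
    using Metric_space.nonneg[OF assms] by (auto intro!: lip_seminorm_le_1I[OF assms])
  then show "{\<bar>(\<integral>z. f z \<partial>return borel x) - (\<integral>z. f z \<partial>return borel y)\<bar> | f.
      continuous_on UNIV f \<and> lip_seminorm d f \<le> 1} \<noteq> {}"
    by blast
next
  fix r
  assume "r \<in> {\<bar>(\<integral>z. f z \<partial>return borel x) - (\<integral>z. f z \<partial>return borel y)\<bar> | f.
      continuous_on UNIV f \<and> lip_seminorm d f \<le> 1}"
  then obtain f where f: "continuous_on UNIV f" "lip_seminorm d f \<le> 1"
    and r: "r = \<bar>(\<integral>z. f z \<partial>return borel x) - (\<integral>z. f z \<partial>return borel y)\<bar>" by blast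
  have "r = \<bar>f x - f y\<bar>"
    using borel_measurable_continuous_onI[OF f(1)] by (simp add: r integral_return)
  then show "r \<le> d x y"
    using lip_seminorm_le_1D[OF assms f(2)] by simp
qed

section \<open>States on a closed set\<close>

text \<open>
  The complement of the support is a union of null open sets, in general an uncountable one.
  A compact set inside it is covered by finitely many of them, hence null, and inner regularity
  passes this on to the whole complement.
\<close>

lemma AE_in_support_set:
  assumes "\<mu> \<in> states_on K"
  shows "AE x in \<mu>. x \<in> K"
proof -
  define \<U> where "\<U> = {U. open U \<and> emeasure \<mu> U = 0}"
  have sets: "sets \<mu> = sets borel" and supp: "- \<Union>\<U> \<subseteq> K"
    and inner: "\<And>A. A \<in> sets borel \<Longrightarrow>
      emeasure \<mu> A = (SUP C\<in>{C. C \<subseteq> A \<and> compact C}. emeasure \<mu> C)"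
    using assms unfolding states_on_def state_space_def regular_borel_def measure_support_def \<U>_def
    by auto
  have "open (\<Union>\<U>)"
    unfolding \<U>_def by blast
  have "emeasure \<mu> C = 0" if C: "C \<subseteq> \<Union>\<U>" "compact C" for C
  proof -
    obtain \<F> where \<F>: "\<F> \<subseteq> \<U>" "finite \<F>" "C \<subseteq> \<Union>\<F>"
      by (rule compactE[OF C(2,1)]) (auto simp: \<U>_def)
    have null: "U \<in> null_sets \<mu>" if "U \<in> \<F>" for U
      using that \<F>(1) by (auto simp: \<U>_def null_sets_def sets)
    have "\<Union>\<F> \<in> null_sets \<mu>"
      using \<F>(2) null by (intro null_sets.finite_Union) auto
    with \<F>(3) show ?thesis
      using emeasure_mono[of C "\<Union>\<F>" \<mu>] by (auto simp: null_sets_def)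
  qed
  then have "(SUP C\<in>{C. C \<subseteq> \<Union>\<U> \<and> compact C}. emeasure \<mu> C) \<le> 0"
    by (intro SUP_least) auto
  with inner[of "\<Union>\<U>"] \<open>open (\<Union>\<U>)\<close> have "emeasure \<mu> (\<Union>\<U>) = 0"
    by simp
  with \<open>open (\<Union>\<U>)\<close> have "\<Union>\<U> \<in> null_sets \<mu>"
    by (auto simp: null_sets_def sets)
  then show ?thesis
    using supp by (intro AE_I'[of "\<Union>\<U>"]) auto
qed

lemma integrable_state:
  fixes f :: "'a::topological_space \<Rightarrow> real"
  assumes "compact (UNIV :: 'a set)" "\<mu> \<in> state_space" "continuous_on UNIV f"
  shows "integrable \<mu> f"
proof -
  interpret prob_space \<mu>
    using assms(2) by (simp add: state_space_def)
  have "sets \<mu> = sets borel"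
    using assms(2) by (simp add: state_space_def regular_borel_def)
  then have meas: "f \<in> borel_measurable \<mu>"
    using borel_measurable_continuous_onI[OF assms(3)] measurable_cong_sets by blast
  obtain B where "\<And>x. norm (f x) \<le> B"
    using compact_imp_bounded[OF compact_continuous_image[OF assms(3,1)]]
    by (auto simp: bounded_iff)
  then show ?thesis
    by (intro integrable_const_bound[of _ B] meas) auto
qed

text \<open>
  This is the lower bound given by the distance to \<open>K\<close> as test function.  Boundedness of the set of
  values \<open>\<bar>\<mu>(f) - \<nu>(f)\<bar>\<close> is what allows one value to bound their real supremum from below.
\<close>

lemma mk_dist_ge_separation:
  fixes d :: "'a::topological_space \<Rightarrow> 'a \<Rightarrow> real"
  assumes cpt: "compact (UNIV :: 'a set)"
    and d: "Metric_space UNIV d" "Metric_space.mtopology UNIV d = euclidean"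
    and "K \<noteq> {}" and \<mu>: "\<mu> \<in> states_on K" and \<nu>: "\<nu> \<in> states_on K'"
    and sep: "\<And>x y. x \<in> K \<Longrightarrow> y \<in> K' \<Longrightarrow> c \<le> d x y"
  shows "c \<le> mk_dist d \<mu> \<nu>"
proof -
  interpret d: Metric_space UNIV d by fact
  define f where "f = (\<lambda>x. INF z\<in>K. d x z)"
  have states: "\<mu> \<in> state_space" "\<nu> \<in> state_space"
    using \<mu> \<nu> by (auto simp: states_on_def)
  interpret \<mu>: prob_space \<mu> using states by (simp add: state_space_def)
  interpret \<nu>: prob_space \<nu> using states by (simp add: state_space_def)
  have lip: "\<bar>f x - f y\<bar> \<le> d x y" for x y
    unfolding f_def by (rule abs_diff_INF_le[OF d(1) \<open>K \<noteq> {}\<close>])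
  note cont = continuous_on_if_Lipschitz[OF d lip]
  have "f x \<le> 0" if "x \<in> K" for x
    unfolding f_def using that by (intro cINF_lower2[where x = x] bdd_belowI[of _ 0]) auto
  then have "(\<integral>x. f x \<partial>\<mu>) \<le> 0"
    using AE_in_support_set[OF \<mu>]
    by (intro \<mu>.integral_le_const integrable_state cpt states cont) (auto elim!: eventually_mono)
  moreover have "c \<le> f y" if "y \<in> K'" for y
    unfolding f_def using that sep \<open>K \<noteq> {}\<close> by (intro cINF_greatest) (auto simp: d.commute)
  then have "c \<le> (\<integral>x. f x \<partial>\<nu>)"
    using AE_in_support_set[OF \<nu>]
    by (intro \<nu>.integral_ge_const integrable_state cpt states cont) (auto elim!: eventually_mono)
  ultimately have "c \<le> \<bar>(\<integral>x. f x \<partial>\<mu>) - (\<integral>x. f x \<partial>\<nu>)\<bar>"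
    by linarith
  also have "\<dots> \<le> mk_dist d \<mu> \<nu>"
    unfolding mk_dist_def
    using cont lip_seminorm_le_1I[OF d(1) lip]
    by (intro cSup_upper mk_dist_bdd_above cpt d states) blast
  finally show ?thesis .
qed

section \<open>Equality of the distances\<close>

theorem proposition3:
  fixes d :: "'a::topological_space \<Rightarrow> 'a \<Rightarrow> real" and K K' :: "'a set"
  assumes "compact (UNIV :: 'a set)"
    and "Metric_space UNIV d"
    and "Metric_space.mtopology UNIV d = euclidean"
    and "closed K" "K \<noteq> {}"
    and "closed K'" "K' \<noteq> {}"
  shows "inf_dist d K K' = inf_dist (mk_dist d) (states_on K) (states_on K')"
proof (rule antisym)
  have le: "inf_dist d K K' \<le> d x y" if "x \<in> K" "y \<in> K'" for x y
    using that Metric_space.nonneg[OF assms(2)] by (rule inf_dist_lower)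
  have mk: "inf_dist d K K' \<le> mk_dist d \<mu> \<nu>"
    if "\<mu> \<in> states_on K" "\<nu> \<in> states_on K'" for \<mu> \<nu>
    using mk_dist_ge_separation[OF assms(1-3,5) that le] .
  have return: "return borel x \<in> states_on S" if "x \<in> S" for x :: 'a and S
    using closed_singleton_if_metric[OF assms(2,3)] that by (rule return_in_states_on)
  show "inf_dist d K K' \<le> inf_dist (mk_dist d) (states_on K) (states_on K')"
    using assms(5,7) return by (intro inf_dist_greatest mk) auto
  show "inf_dist (mk_dist d) (states_on K) (states_on K') \<le> inf_dist d K K'"
  proof (rule inf_dist_greatest[OF assms(5,7)])
    fix x y assume "x \<in> K" "y \<in> K'"
    then have "inf_dist (mk_dist d) (states_on K) (states_on K')
        \<le> mk_dist d (return borel x) (return borel y)"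
      by (intro inf_dist_lower[OF return return mk])
    also have "\<dots> \<le> d x y"
      by (rule mk_dist_return_le[OF assms(2)])
    finally show "inf_dist (mk_dist d) (states_on K) (states_on K') \<le> d x y" .
  qed
qed

end
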